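(* Let $\varrho>0$ and suppose that $\mathcal M$ and $\mathcal N$ are two disk-type surfaces that are singly $\varrho$-$_{H}$fittable, with conformal factors $\mu$ and $\nu$ respectively. If $\mathbf d^R(\mathcal M,\mathcal N)=0$ for some $R>\varrho$, then there exists a Möbius transformation $m\in M_{\mathcal D}$ that is a global isometry between $\mathcal M=(\mathcal D,\mu)$ and $\mathcal N=(\mathcal D,\nu)$, i.e. $\nu(m(z))=\mu(z)$ for all $z\in\mathcal D$.
   Context: $\mathcal D=\{z\in\mathbb C:|z|<1\}$, with hyperbolic area measure $d\mathrm{vol}_H(z)=(1-|z|^2)^{-2}\,dx^1\wedge dx^2$ for $z=x^1+ix^2$. $M_{\mathcal D}$ is the group of disk-preserving Möbius transformations $m(z)=e^{i\theta}\frac{z-a}{1-\bar a z}$, $a\in\mathcal D$, $\theta\in[0,2\pi)$. For $m\in M_{\mathcal D}$: $m_*\mu=\mu\circ m^{-1}$. For $R>0$, $\Omega_{z_0,R}=\{z\in\mathcal D:\left|\frac{z-z_0}{1-\bar z_0z}\right|\le\tanh R\}$ is the hyperbolic geodesic disk of radius $R$ centered at $z_0$. A disk-type surface $\mathcal M$ is a surface with a smooth Riemannian metric, normalized to total area $1$, that admits an (orientation-preserving) conformal uniformization map onto $\mathcal D$. Such a map pushes the metric forward to $\mu(z)(1-|z|^2)^{-2}\delta_{ij}\,dx^i\otimes dx^j$, where $\mu>0$ is smooth and $\int_{\mathcal D}\mu\,d\mathrm{vol}_H=1$; $\mu$ is called a conformal factor of $\mathcal M$, and one writes $\mathcal M=(\mathcal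 D,\mu)$. The conformal factors of a given surface obtained from different uniformization maps are exactly the functions $m_*\mu$, $m\in M_{\mathcal D}$. The symbol $\mu$ also denotes the probability measure $\mu\,d\mathrm{vol}_H$. $\Pi(\mu,\nu)$ is the set of probability measures on $\mathcal D\times\mathcal D$ with marginals $\mu$ and $\nu$. For $z_0,w_0\in\mathcal D$, $$d^R_{\mu,\nu}(z_0,w_0)=\inf_{m\in M_{\mathcal D},\,m(z_0)=w_0}\int_{\Omega_{z_0,R}}|\mu(z)-\nu(m(z))|\,d\mathrm{vol}_H(z),$$ and $\mathbf d^R(\mathcal M,\mathcal N)=\inf_{\pi\in\Pi(\mu,\nu)}\int_{\mathcal D\times\mathcal D}d^R_{\mu,\nu}(z,w)\,d\pi(z,w)$. Definition: a disk-type surface $\mathcal M$ is singly $\varrho$-$_{H}$fittable ($\varrho>0$) if, for all $R>\varrho$, all $z_0\in\mathcal D$, and all conformal factors $\mu$ obtained in uniformizations of $\mathcal M$, there is no $m\in M_{\mathcal D}$ other than the identity for which $\int_{\Omega_{z_0,R}}|\mu(z)-\mu(m(z))|\,d\mathrm{vol}_H(z)=0$. *)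

theory Defs
  imports "HOL-Analysis.Analysis" "HOL-Complex_Analysis.Complex_Analysis" "HOL-Probability.Probability"
begin

section \<open>Smooth functions and Riemannian surfaces\<close>

text \<open>To be used on open sets only, where \<open>frechet_derivative f (at x) v\<close> is the derivative
  of \<open>f\<close> at \<open>x\<close> in direction \<open>v\<close>. The plane is \<open>complex\<close> as a two-dimensional real
  vector space; derivatives are real, not complex.\<close>

primrec Ck_on :: "nat \<Rightarrow> complex set \<Rightarrow> (complex \<Rightarrow> 'b::real_normed_vector) \<Rightarrow> bool" where
  "Ck_on 0 A f \<longleftrightarrow> continuous_on A f"
| "Ck_on (Suc k) A f \<longleftrightarrow>
     (\<forall>x\<in>A. f differentiable (at x)) \<and> (\<forall>v. Ck_on k A (\<lambda>x. frechet_derivative f (at x) v))"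

definition smooth_on :: "complex set \<Rightarrow> (complex \<Rightarrow> 'b::real_normed_vector) \<Rightarrow> bool" where
  "smooth_on A f \<longleftrightarrow> (\<forall>k. Ck_on k A f)"

text \<open>The determinant of a real-linear map of the plane, with respect to the basis \<open>1, \<i>\<close>.\<close>

definition plane_det :: "(complex \<Rightarrow> complex) \<Rightarrow> real" where
  "plane_det L = Re (L 1) * Im (L \<i>) - Im (L 1) * Re (L \<i>)"

type_synonym 'a chart = "'a set \<times> ('a \<Rightarrow> complex)"

text \<open>\<open>riem S c p v w\<close> is the inner product at the point \<open>p\<close> of the two tangent vectors
  whose coordinate expressions in the chart \<open>c\<close> are \<open>v\<close> and \<open>w\<close>.\<close>

record 'a surface =
  points :: "'a set"
  atlas :: "'a chart set"
  riem :: "'a chart \<Rightarrow> 'a \<Rightarrow> complex \<Rightarrow> complex \<Rightarrow> real"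

text \<open>The coordinate expression of a function on the surface, and its derivative at a point.\<close>

definition in_chart :: "'a chart \<Rightarrow> ('a \<Rightarrow> complex) \<Rightarrow> complex \<Rightarrow> complex" where
  "in_chart c f = f \<circ> inv_into (fst c) (snd c)"

definition chart_deriv :: "'a chart \<Rightarrow> ('a \<Rightarrow> complex) \<Rightarrow> 'a \<Rightarrow> complex \<Rightarrow> complex" where
  "chart_deriv c f p = frechet_derivative (in_chart c f) (at (snd c p))"

text \<open>An oriented smooth surface with a smooth Riemannian metric. The topology is the one
  generated by the atlas; being Hausdorff and second countable is not listed separately, since
  below the surface is always assumed to be diffeomorphic to the unit disk.\<close>

definition riemannian_surface :: "'a surface \<Rightarrow> bool" where
  "riemannian_surface S \<longleftrightarrow>
     (\<Union>c\<in>atlas S. fst c) = points S \<and>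
     (\<forall>c\<in>atlas S. inj_on (snd c) (fst c) \<and> open (snd c ` fst c)) \<and>
     (\<forall>c\<in>atlas S. \<forall>d\<in>atlas S.
        open (snd c ` (fst c \<inter> fst d)) \<and>
        smooth_on (snd c ` (fst c \<inter> fst d)) (in_chart c (snd d)) \<and>
        (\<forall>p\<in>fst c \<inter> fst d. plane_det (chart_deriv c (snd d) p) > 0)) \<and>
     (\<forall>c\<in>atlas S. \<forall>p\<in>fst c.
        bilinear (riem S c p) \<and>
        (\<forall>v w. riem S c p v w = riem S c p w v) \<and>
        (\<forall>v. v \<noteq> 0 \<longrightarrow> riem S c p v v > 0)) \<and>
     (\<forall>c\<in>atlas S. \<forall>v w.
        smooth_on (snd c ` fst c) (\<lambda>x. riem S c (inv_into (fst c) (snd c) x) v w)) \<and>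
     (\<forall>c\<in>atlas S. \<forall>d\<in>atlas S. \<forall>p\<in>fst c \<inter> fst d. \<forall>v w.
        riem S c p v w
          = riem S d p (chart_deriv c (snd d) p v) (chart_deriv c (snd d) p w))"

section \<open>Hyperbolic disk and disk-type surfaces\<close>

abbreviation unit_disk :: "complex set" where
  "unit_disk \<equiv> ball 0 1"

definition hyp_area :: "complex measure" where
  "hyp_area = density (restrict_space lborel unit_disk) (\<lambda>z. ennreal (1 / (1 - (cmod z)\<^sup>2)\<^sup>2))"

text \<open>\<open>Moebius_function \<theta> a z = exp(\<i> \<theta>) (z - a) / (1 - cnj a z)\<close>. Elements are functions on all
  of \<open>complex\<close>, but only their values on the disk are meaningful.\<close>

definition disk_moebius :: "(complex \<Rightarrow> complex) set" where
  "disk_moebius = {Moebius_function \<theta> a | \<theta> a. 0 \<le> \<theta> \<and> \<theta> < 2 * pi \<and> a \<in> unit_disk}"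

definition hyp_disk :: "complex \<Rightarrow> real \<Rightarrow> complex set" where
  "hyp_disk z0 R = {z \<in> unit_disk. cmod ((z - z0) / (1 - cnj z0 * z)) \<le> tanh R}"

text \<open>Orientation-preserving conformal diffeomorphisms onto the disk: the differential has positive
  determinant (so the inverse is smooth as well), and the metric is a positive multiple of the
  pulled back Euclidean metric.\<close>

definition uniformization :: "'a surface \<Rightarrow> ('a \<Rightarrow> complex) \<Rightarrow> bool" where
  "uniformization S u \<longleftrightarrow>
     bij_betw u (points S) unit_disk \<and>
     (\<forall>c\<in>atlas S.
        smooth_on (snd c ` fst c) (in_chart c u) \<and>
        (\<forall>p\<in>fst c. plane_det (chart_deriv c u p) > 0 \<and>
           (\<exists>l>0. \<forall>v w. riem S c p v w = l * (chart_deriv c u p v \<bullet> chart_deriv c u p w))))"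

text \<open>The last conjunct says that \<open>u\<close> pushes the metric forward to
  \<open>\<mu>(z) (1 - |z|\<^sup>2)\<^sup>-\<^sup>2 \<delta>\<^sub>i\<^sub>j dx\<^sup>i \<otimes> dx\<^sup>j\<close>. Values of \<open>\<mu>\<close> outside the disk are irrelevant.\<close>

definition conformal_factor_via ::
    "'a surface \<Rightarrow> ('a \<Rightarrow> complex) \<Rightarrow> (complex \<Rightarrow> real) \<Rightarrow> bool" where
  "conformal_factor_via S u \<mu> \<longleftrightarrow>
     uniformization S u \<and> smooth_on unit_disk \<mu> \<and> (\<forall>z\<in>unit_disk. \<mu> z > 0) \<and>
     (\<forall>c\<in>atlas S. \<forall>p\<in>fst c. \<forall>v w.
        riem S c p v w
          = \<mu> (u p) / (1 - (cmod (u p))\<^sup>2)\<^sup>2 * (chart_deriv c u p v \<bullet> chart_deriv c u p w))"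

definition conformal_factor :: "'a surface \<Rightarrow> (complex \<Rightarrow> real) \<Rightarrow> bool" where
  "conformal_factor S \<mu> \<longleftrightarrow> (\<exists>u. conformal_factor_via S u \<mu>)"

text \<open>The measure \<open>\<mu> dvol\<^sub>H\<close> is the image under \<open>u\<close> of the area measure of the surface, so the last
  conjunct is the normalization of the total area.\<close>

definition disk_type_surface :: "'a surface \<Rightarrow> bool" where
  "disk_type_surface S \<longleftrightarrow>
     riemannian_surface S \<and> (\<exists>u. uniformization S u) \<and>
     (\<forall>\<mu>. conformal_factor S \<mu> \<longrightarrow> (\<integral>\<^sup>+z. ennreal (\<mu> z) \<partial>hyp_area) = 1)"

section \<open>The conformal Wasserstein distance\<close>

text \<open>All integrands are nonnegative, so the integrals are taken with values in \<open>ennreal\<close>.\<close>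

definition local_mismatch ::
    "real \<Rightarrow> (complex \<Rightarrow> real) \<Rightarrow> (complex \<Rightarrow> real) \<Rightarrow> complex \<Rightarrow> complex \<Rightarrow> ennreal" where
  "local_mismatch R \<mu> \<nu> z0 w0 =
     (INF m \<in> {m \<in> disk_moebius. m z0 = w0}.
        \<integral>\<^sup>+z\<in>hyp_disk z0 R. ennreal \<bar>\<mu> z - \<nu> (m z)\<bar> \<partial>hyp_area)"

definition factor_measure :: "(complex \<Rightarrow> real) \<Rightarrow> complex measure" where
  "factor_measure \<mu> = density hyp_area (\<lambda>z. ennreal (\<mu> z))"

definition couplings ::
    "(complex \<Rightarrow> real) \<Rightarrow> (complex \<Rightarrow> real) \<Rightarrow> (complex \<times> complex) measure set" where
  "couplings \<mu> \<nu> =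
     {\<pi>. prob_space \<pi> \<and> sets \<pi> = sets (hyp_area \<Otimes>\<^sub>M hyp_area) \<and>
         distr \<pi> hyp_area fst = factor_measure \<mu> \<and>
         distr \<pi> hyp_area snd = factor_measure \<nu>}"

definition conformal_wasserstein ::
    "real \<Rightarrow> (complex \<Rightarrow> real) \<Rightarrow> (complex \<Rightarrow> real) \<Rightarrow> ennreal" where
  "conformal_wasserstein R \<mu> \<nu> =
     (INF \<pi> \<in> couplings \<mu> \<nu>. \<integral>\<^sup>+x. local_mismatch R \<mu> \<nu> (fst x) (snd x) \<partial>\<pi>)"

text \<open>Being the identity is meant as a map of the disk.\<close>

definition singly_fittable :: "real \<Rightarrow> 'a surface \<Rightarrow> bool" where
  "singly_fittable \<rho> S \<longleftrightarrow>
     (\<forall>R>\<rho>. \<forall>z0\<in>unit_disk. \<forall>\<mu>. conformal_factor S \<mu> \<longrightarrow>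
        \<not> (\<exists>m\<in>disk_moebius. (\<exists>z\<in>unit_disk. m z \<noteq> z) \<and>
             (\<integral>\<^sup>+z\<in>hyp_disk z0 R. ennreal \<bar>\<mu> z - \<mu> (m z)\<bar> \<partial>hyp_area) = 0))"

end

theory Submission
  imports Defs
begin

text \<open>Fix a disk point \<open>z\<^sub>0\<close>. A coupling of almost zero cost puts a definite amount of mass on pairs
  \<open>(z, w)\<close> with \<open>z\<close> near \<open>z\<^sub>0\<close> and \<open>w\<close> in a fixed compact set, so some such pair is matched by a
  disk automorphism with almost zero mismatch. These automorphisms stay in a compact family, and a
  limit \<open>m\<close> satisfies \<open>\<nu> \<circ> m = \<mu>\<close> on a hyperbolic disk around \<open>z\<^sub>0\<close> of radius slightly below \<open>R\<close>;
  in particular no optimal coupling is needed. For nearby centres the two disks share a disk of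
  radius above \<open>\<rho>\<close>, on which the two automorphisms must agree by single fittability of the second
  surface. So the automorphism does not depend on the centre, the disk being connected.\<close>

section \<open>Disk automorphisms and the pseudo-hyperbolic distance\<close>

text \<open>Trading the angle for a unimodular factor makes the parameters \<open>(u, a)\<close>
  range over circle times disk, where compactness can be used. The angle is recovered as
  \<open>Arg2pi u\<close>, which lies in the required half-open interval.\<close>

lemma disk_moebius_eq:
  "disk_moebius = {(\<lambda>z. u * (z - a) / (1 - cnj a * z)) | u a. cmod u = 1 \<and> cmod a < 1}"
proof (intro equalityI subsetI)
  fix m assume "m \<in> disk_moebius"
  then obtain t a where "m = Moebius_function t a" "a \<in> unit_disk"
    unfolding disk_moebius_def by blast
  then show "m \<in> {(\<lambda>z. u * (z - a) / (1 - cnj a * z)) | u a. cmod u = 1 \<and> cmod a < 1}"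
    unfolding Moebius_function_def
    by (intro CollectI, rule_tac x = "exp (\<i> * of_real t)" in exI, rule_tac x = a in exI) auto
next
  fix m assume "m \<in> {(\<lambda>z. u * (z - a) / (1 - cnj a * z)) | u a. cmod u = 1 \<and> cmod a < 1}"
  then obtain u a where m: "m = (\<lambda>z. u * (z - a) / (1 - cnj a * z))" "cmod u = 1" "cmod a < 1"
    by blast
  have "u = exp (\<i> * of_real (Arg2pi u))"
    using Arg2pi_eq[of u] m(2) by simp
  then have "m = Moebius_function (Arg2pi u) a"
    unfolding m(1) Moebius_function_def by metis
  moreover have "0 \<le> Arg2pi u" "Arg2pi u < 2 * pi"
    by (simp_all add: Arg2pi_ge_0 Arg2pi_lt_2pi)
  ultimately show "m \<in> disk_moebius"
    using m(3) unfolding disk_moebius_def by auto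
qed

lemma disk_moebiusI:
  "cmod u = 1 \<Longrightarrow> cmod a < 1 \<Longrightarrow> (\<lambda>z. u * (z - a) / (1 - cnj a * z)) \<in> disk_moebius"
  by (auto simp: disk_moebius_eq)

lemma one_minus_cnj_mult_nonzero:
  assumes "cmod a < 1" "cmod z < 1"
  shows "1 - cnj a * z \<noteq> 0"
proof
  assume "1 - cnj a * z = 0"
  then have "cmod a * cmod z = 1"
    by (metis complex_mod_cnj eq_iff_diff_eq_0 norm_mult norm_one)
  moreover have "cmod a * cmod z < 1 * 1"
    using assms by (intro mult_strict_mono') auto
  ultimately show False by simp
qed

text \<open>The pseudo-hyperbolic distance: tanh of the hyperbolic distance, in the normalization in
  which \<open>hyp_disk z0 R\<close> is the closed ball of radius \<open>R\<close>.\<close>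

definition pdist :: "complex \<Rightarrow> complex \<Rightarrow> real" where
  "pdist a z = cmod ((z - a) / (1 - cnj a * z))"

lemma pdist_nonneg [simp]: "0 \<le> pdist a z"
  by (simp add: pdist_def)

text \<open>Serves twice: positivity of the right side gives \<open>pdist < 1\<close>, and solving
  for \<open>1 - (cmod a)\<^sup>2\<close> later keeps the zero of an automorphism away from the unit
  circle.\<close>

lemma one_minus_pdist:
  assumes "cmod a < 1" "cmod z < 1"
  shows "1 - (pdist a z)\<^sup>2 = (1 - (cmod a)\<^sup>2) * (1 - (cmod z)\<^sup>2) / (cmod (1 - cnj a * z))\<^sup>2"
proof -
  have "(cmod (1 - cnj a * z))\<^sup>2 - (cmod (z - a))\<^sup>2 = (1 - (cmod a)\<^sup>2) * (1 - (cmod z)\<^sup>2)"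
    unfolding cmod_power2 by (simp add: algebra_simps power2_eq_square)
  then show ?thesis
    using one_minus_cnj_mult_nonzero[OF assms]
    by (simp add: pdist_def norm_divide power_divide divide_simps)
qed

lemma pdist_less_1:
  assumes "cmod a < 1" "cmod z < 1"
  shows "pdist a z < 1"
proof -
  have "0 < (1 - (cmod a)\<^sup>2) * (1 - (cmod z)\<^sup>2) / (cmod (1 - cnj a * z))\<^sup>2"
    using assms one_minus_cnj_mult_nonzero[OF assms]
    by (intro divide_pos_pos mult_pos_pos) (auto simp: abs_square_less_1)
  then have "(pdist a z)\<^sup>2 < 1"
    using one_minus_pdist[OF assms] by linarith
  then show ?thesis
    by (simp add: abs_square_less_1)
qed

lemma continuous_on_pdist: "continuous_on unit_disk (\<lambda>z. pdist a z)" if "cmod a < 1"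
  unfolding pdist_def using one_minus_cnj_mult_nonzero[OF that]
  by (auto intro!: continuous_intros)

lemma norm_disk_moebius:
  assumes "cmod u = 1"
  shows "cmod (u * (z - a) / (1 - cnj a * z)) = pdist a z"
  using assms by (simp add: pdist_def norm_mult norm_divide)

lemma disk_moebius_maps:
  assumes "m \<in> disk_moebius" "z \<in> unit_disk"
  shows "m z \<in> unit_disk"
  using assms by (auto simp: disk_moebius_eq norm_disk_moebius pdist_less_1)

text \<open>Numerator and denominator of \<open>pdist (m z) (m w)\<close> pick up the same factor up
  to modulus, because \<open>1 - cnj z * a\<close> and \<open>1 - cnj a * z\<close> are
  conjugate.\<close>

lemma pdist_disk_moebius:
  assumes "m \<in> disk_moebius" "z \<in> unit_disk" "w \<in> unit_disk"
  shows "pdist (m z) (m w) = pdist z w"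
proof -
  obtain u a where m: "m = (\<lambda>z. u * (z - a) / (1 - cnj a * z))" and u: "cmod u = 1" and a: "cmod a < 1"
    using assms(1) by (auto simp: disk_moebius_eq)
  have z: "cmod z < 1" and w: "cmod w < 1" using assms by auto
  note nz = one_minus_cnj_mult_nonzero[OF a z] one_minus_cnj_mult_nonzero[OF a w]
    one_minus_cnj_mult_nonzero[OF z w] one_minus_cnj_mult_nonzero[OF z a]
  have uu: "u * cnj u = 1" using u by (simp add: complex_norm_square[symmetric])
  define k where "k = 1 - a * cnj a"
  have kc: "k \<noteq> 0" using one_minus_cnj_mult_nonzero[OF a a] by (simp add: k_def mult.commute)
  have num: "m w - m z = u * (w - z) * k / ((1 - cnj a * w) * (1 - cnj a * z))"
    using nz unfolding m k_def by (simp add: divide_simps) (simp add: algebra_simps)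
  have "cnj (m z) * m w = (u * cnj u) * ((cnj z - cnj a) * (w - a) / ((1 - cnj z * a) * (1 - cnj a * w)))"
    unfolding m by (simp add: mult.commute mult.left_commute)
  then have den: "1 - cnj (m z) * m w = (1 - cnj z * w) * k / ((1 - cnj z * a) * (1 - cnj a * w))"
    using nz unfolding uu k_def by (simp add: divide_simps) (simp add: algebra_simps)
  have "cmod (1 - cnj z * a) = cmod (1 - cnj a * z)"
    by (metis complex_cnj_cnj complex_cnj_diff complex_cnj_mult complex_cnj_one complex_mod_cnj mult.commute)
  then show ?thesis
    using nz kc u unfolding pdist_def num den by (simp add: norm_divide norm_mult)
qed

text \<open>A crude triangle inequality, obtained by moving \<open>a\<close> to 0, where
  \<open>pdist\<close> is the modulus. Its right side tends to \<open>pdist a c\<close> as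
  \<open>b\<close> approaches \<open>a\<close>, so it suffices for small shifts of the
  centre.\<close>

lemma pdist_triangle:
  assumes "cmod a < 1" "cmod b < 1" "cmod c < 1"
  shows "pdist b c \<le> (pdist a b + pdist a c) / (1 - pdist a b)"
proof -
  define m where "m = (\<lambda>z. 1 * (z - a) / (1 - cnj a * z))"
  have m: "m \<in> disk_moebius"
    unfolding m_def by (rule disk_moebiusI) (use assms in auto)
  have nm: "cmod (m z) = pdist a z" for z
    unfolding m_def by (rule norm_disk_moebius) simp
  have lt: "pdist a b < 1" "pdist a c < 1" using assms pdist_less_1 by auto
  have "cmod (cnj (m b) * m c) \<le> pdist a b * 1"
    unfolding norm_mult complex_mod_cnj nm using lt by (intro mult_left_mono) auto
  moreover have "1 - cmod (cnj (m b) * m c) \<le> cmod (1 - cnj (m b) * m c)"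
    using norm_triangle_ineq2[of 1 "cnj (m b) * m c"] by simp
  ultimately have den: "1 - pdist a b \<le> cmod (1 - cnj (m b) * m c)" by simp
  have num: "cmod (m c - m b) \<le> pdist a b + pdist a c"
    using norm_triangle_ineq4[of "m c" "m b"] by (simp add: nm)
  have "pdist b c = pdist (m b) (m c)"
    using pdist_disk_moebius[OF m, of b c] assms by simp
  also have "\<dots> \<le> (pdist a b + pdist a c) / (1 - pdist a b)"
    unfolding pdist_def[of "m b"] norm_divide using num den lt
    by (intro frac_le) auto
  finally show ?thesis .
qed

text \<open>The gap between \<open>r\<close> and \<open>s\<close> absorbs a small shift of the
  centre, uniformly in \<open>x\<close>.\<close>

lemma eventually_pdist_le:
  assumes "cmod a < 1" "r < s"
  shows "eventually (\<lambda>b. \<forall>x\<in>unit_disk. pdist a x \<le> r \<longrightarrow> pdist b x \<le> s) (at a)"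
proof -
  have "isCont (pdist a) a"
    using continuous_on_pdist[OF assms(1)] assms(1)
    by (simp add: continuous_on_eq_continuous_at)
  then have "(pdist a \<longlongrightarrow> pdist a a) (at a)" by (simp add: isCont_def)
  then have p: "(pdist a \<longlongrightarrow> 0) (at a)" by (simp add: pdist_def)
  then have "((\<lambda>b. (pdist a b + r) / (1 - pdist a b)) \<longlongrightarrow> (0 + r) / (1 - 0)) (at a)"
    by (intro tendsto_intros) auto
  then have "eventually (\<lambda>b. (pdist a b + r) / (1 - pdist a b) < s) (at a)"
    using assms(2) by (intro order_tendstoD) auto
  moreover have "eventually (\<lambda>b. b \<in> unit_disk) (at a)"
    using assms(1) by (intro eventually_at_in_open') auto
  ultimately show ?thesis
  proof eventually_elim
    case (elim b)
    show ?case
    proof (intro ballI impI)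
      fix x assume x: "x \<in> unit_disk" "pdist a x \<le> r"
      have "pdist b x \<le> (pdist a b + pdist a x) / (1 - pdist a b)"
        using pdist_triangle[of a b x] assms elim x by simp
      also have "\<dots> \<le> (pdist a b + r) / (1 - pdist a b)"
        using x pdist_less_1[of a b] assms elim by (intro divide_right_mono) auto
      finally show "pdist b x \<le> s" using elim by simp
    qed
  qed
qed

lemma disk_moebius_inverse:
  assumes "m \<in> disk_moebius"
  obtains m' where "m' \<in> disk_moebius" "\<And>z. z \<in> unit_disk \<Longrightarrow> m (m' z) = z"
    "\<And>z. z \<in> unit_disk \<Longrightarrow> m' (m z) = z"
proof -
  \<comment> \<open>The candidate inverse has factor \<open>cnj u\<close> and zero
    \<open>-u * a\<close>. Keeping the parameters general allows a second use with those of the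
    inverse.\<close>
  have inv: "cnj u * (y - (-u * a)) / (1 - cnj (-u * a) * y) = z"
    if u: "u * cnj u = 1" and a: "cmod a < 1" and z: "cmod z < 1"
      and y: "y = u * (z - a) / (1 - cnj a * z)" for u a y z
  proof -
    note nz = one_minus_cnj_mult_nonzero[OF a z] one_minus_cnj_mult_nonzero[OF a a]
    have "y - (-u * a) = u * (z * (1 - cnj a * a)) / (1 - cnj a * z)"
      using nz unfolding y by (simp add: divide_simps) (simp add: algebra_simps)
    then have 1: "cnj u * (y - (-u * a)) = (u * cnj u) * (z * (1 - cnj a * a)) / (1 - cnj a * z)"
      by (simp add: mult_ac)
    have 2: "cnj (-u * a) * y = - (u * cnj u) * (cnj a * (z - a) / (1 - cnj a * z))"
      unfolding y by (simp add: mult_ac)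
    have 2: "1 - cnj (-u * a) * y = (1 - cnj a * a) / (1 - cnj a * z)"
      using nz unfolding 2 u by (simp add: divide_simps) (simp add: algebra_simps)
    show ?thesis
      using nz by (simp only: 1 2 u) simp
  qed
  obtain u a where m: "m = (\<lambda>z. u * (z - a) / (1 - cnj a * z))" and u: "cmod u = 1" and a: "cmod a < 1"
    using assms by (auto simp: disk_moebius_eq)
  define m' where "m' = (\<lambda>y. cnj u * (y - (-u * a)) / (1 - cnj (-u * a) * y))"
  have uu: "u * cnj u = 1" using u by (simp add: complex_norm_square[symmetric])
  have m': "m' \<in> disk_moebius"
    unfolding m'_def by (rule disk_moebiusI) (use u a in \<open>auto simp: norm_mult\<close>)
  show thesis
  proof (rule that[OF m'])
    fix z :: complex assume z: "z \<in> unit_disk"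
    show "m' (m z) = z"
      unfolding m'_def m using inv[OF uu a, of z] z by simp
    \<comment> \<open>The same recipe applied to \<open>m'\<close> leads back to \<open>m\<close>,
      since its new zero simplifies to \<open>a\<close>.\<close>
    have eq: "cnj (cnj u) * (m' z - (- cnj u * (-u * a))) / (1 - cnj (- cnj u * (-u * a)) * m' z) = z"
      by (rule inv) (use u uu a z m'_def in \<open>auto simp: norm_mult mult.commute\<close>)
    have "- cnj u * (-u * a) = a"
      using uu by (metis minus_mult_minus mult.assoc mult.commute mult_1)
    then show "m (m' z) = z"
      using eq unfolding m by (simp only: complex_cnj_cnj)
  qed
qed

text \<open>Up to the common denominator of \<open>n z\<close>, the numerator of the composite is
  \<open>u * (p * z - q)\<close> and its denominator is \<open>v * (cnj p - cnj q * z)\<close>.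
  Hence the zero is \<open>q / p\<close>, and it lies in the disk because
  \<open>cmod q < cmod p\<close>.\<close>

lemma disk_moebius_compose:
  assumes "m \<in> disk_moebius" "n \<in> disk_moebius"
  obtains h where "h \<in> disk_moebius" "\<And>z. z \<in> unit_disk \<Longrightarrow> h z = m (n z)"
proof -
  obtain u a where m: "m = (\<lambda>z. u * (z - a) / (1 - cnj a * z))" and u: "cmod u = 1" and a: "cmod a < 1"
    using assms by (auto simp: disk_moebius_eq)
  obtain v b where n: "n = (\<lambda>z. v * (z - b) / (1 - cnj b * z))" and v: "cmod v = 1" and b: "cmod b < 1"
    using assms by (auto simp: disk_moebius_eq)
  have vv: "v * cnj v = 1" using v by (simp add: complex_norm_square[symmetric])
  have vnz: "v \<noteq> 0" using v by auto
  define p where "p = v + a * cnj b"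
  define q where "q = v * b + a"
  have cp: "v * cnj p = 1 + cnj a * (v * b)"
    using vv by (simp add: p_def algebra_simps)
  have cq: "v * cnj q = cnj b + cnj a * v"
    using vv by (simp add: q_def algebra_simps)
  have "1 - cnj (- a) * (v * b) \<noteq> 0"
    by (rule one_minus_cnj_mult_nonzero) (use a b v in \<open>auto simp: norm_mult\<close>)
  then have "v * cnj p \<noteq> 0"
    unfolding cp by simp
  then have p: "p \<noteq> 0"
    by auto
  have "(cmod p)\<^sup>2 - (cmod q)\<^sup>2 = (1 - (cmod a)\<^sup>2) * (1 - (cmod b)\<^sup>2)"
  proof -
    have "complex_of_real ((cmod p)\<^sup>2 - (cmod q)\<^sup>2) = p * cnj p - q * cnj q"
      by (simp only: of_real_diff complex_norm_square)
    also have "\<dots> = (v * cnj v) * (1 - b * cnj b) - a * cnj a * (1 - b * cnj b)"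
      by (simp add: p_def q_def algebra_simps)
    also have "\<dots> = complex_of_real ((1 - (cmod a)\<^sup>2) * (1 - (cmod b)\<^sup>2))"
      unfolding vv by (simp add: complex_norm_square[symmetric]) (simp add: algebra_simps)
    finally show ?thesis
      using of_real_eq_iff by blast
  qed
  moreover have "0 < (1 - (cmod a)\<^sup>2) * (1 - (cmod b)\<^sup>2)"
    using a b by (intro mult_pos_pos) (auto simp: abs_square_less_1)
  ultimately have "(cmod q)\<^sup>2 < (cmod p)\<^sup>2" by linarith
  then have qp: "cmod q < cmod p"
    using power2_less_imp_less by fastforce
  define h where "h = (\<lambda>z. (u * p / (v * cnj p)) * (z - q / p) / (1 - cnj (q / p) * z))"
  have "cmod (u * p / (v * cnj p)) = 1" "cmod (q / p) < 1"
    using u v p qp by (simp_all add: norm_mult norm_divide)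
  then have "h \<in> disk_moebius"
    unfolding h_def by (rule disk_moebiusI)
  moreover have "h z = m (n z)" if "z \<in> unit_disk" for z
  proof -
    have z: "cmod z < 1" using that by simp
    have nz: "1 - cnj b * z \<noteq> 0" using one_minus_cnj_mult_nonzero[OF b z] .
    have "n z - a = (p * z - q) / (1 - cnj b * z)"
      using nz by (simp add: n p_def q_def divide_simps) (simp add: algebra_simps)
    moreover have "1 - cnj a * n z = (v * cnj p - v * cnj q * z) / (1 - cnj b * z)"
      using nz unfolding cp cq by (simp add: n divide_simps) (simp add: algebra_simps)
    ultimately have "m (n z) = u * (p * z - q) / (v * cnj p - v * cnj q * z)"
      using nz by (simp add: m)
    moreover have "z - q / p = (p * z - q) / p"
      using p by (simp add: field_simps)
    moreover have "1 - cnj (q / p) * z = (v * cnj p - v * cnj q * z) / (v * cnj p)"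
      using p vnz by (simp add: field_simps)
    ultimately show ?thesis
      using p vnz by (simp add: h_def)
  qed
  ultimately show thesis using that by blast
qed

section \<open>Mass estimates for hyperbolic area, conformal factors and couplings\<close>

lemma space_hyp_area [simp]: "space hyp_area = unit_disk"
  by (simp add: hyp_area_def)

lemma sets_hyp_area: "A \<in> sets hyp_area \<longleftrightarrow> A \<in> sets borel \<and> A \<subseteq> unit_disk"
proof -
  have "sets hyp_area = sets (restrict_space lborel unit_disk)"
    by (simp add: hyp_area_def)
  then show ?thesis
    by (auto simp: sets_restrict_space_iff)
qed

lemma borel_measurable_hyp_area:
  fixes f :: "complex \<Rightarrow> 'b::topological_space"
  assumes "continuous_on unit_disk f"
  shows "f \<in> borel_measurable hyp_area"
proof -
  have "f \<in> borel_measurable (restrict_space borel unit_disk)"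
    by (rule borel_measurable_continuous_on_restrict[OF assms])
  moreover have "sets hyp_area = sets (restrict_space borel unit_disk)"
    by (simp add: hyp_area_def sets_restrict_space)
  ultimately show ?thesis
    by (simp cong: measurable_cong_sets)
qed

text \<open>The hyperbolic density is at least 1 on the disk; this transfers positivity of the area
  of balls from Lebesgue measure.\<close>

lemma lborel_le_hyp_area:
  assumes "A \<in> sets borel" "A \<subseteq> unit_disk"
  shows "emeasure lborel A \<le> emeasure hyp_area A"
proof -
  let ?L = "restrict_space lborel unit_disk"
  have A: "A \<in> sets ?L" using assms by (auto simp: sets_restrict_space_iff)
  have meas: "(\<lambda>z. ennreal (1 / (1 - (cmod z)\<^sup>2)\<^sup>2)) \<in> borel_measurable ?L"
    by (rule measurable_restrict_space1) measurable
  have "emeasure lborel A = emeasure ?L A"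
    using assms by (subst emeasure_restrict_space) auto
  also have "\<dots> = (\<integral>\<^sup>+z. indicator A z \<partial>?L)"
    using A by simp
  also have "\<dots> \<le> (\<integral>\<^sup>+z. ennreal (1 / (1 - (cmod z)\<^sup>2)\<^sup>2) * indicator A z \<partial>?L)"
  proof (rule nn_integral_mono)
    fix z assume "z \<in> space ?L"
    then have "cmod z < 1" by simp
    then have "0 < 1 - (cmod z)\<^sup>2" "1 - (cmod z)\<^sup>2 \<le> 1" by (auto simp: abs_square_less_1)
    then have "(1 - (cmod z)\<^sup>2)\<^sup>2 \<le> 1" "0 < (1 - (cmod z)\<^sup>2)\<^sup>2"
      by (auto intro: power_le_one)
    then have "1 \<le> 1 / (1 - (cmod z)\<^sup>2)\<^sup>2" by simp
    then show "indicator A z \<le> ennreal (1 / (1 - (cmod z)\<^sup>2)\<^sup>2) * indicator A z"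
      by (auto simp: indicator_def)
  qed
  also have "\<dots> = emeasure hyp_area A"
    unfolding hyp_area_def by (rule emeasure_density[symmetric, OF meas A])
  finally show ?thesis .
qed

lemma hyp_area_ball_pos:
  assumes "e > 0" "ball z e \<subseteq> unit_disk"
  shows "0 < emeasure hyp_area (ball z e)"
proof -
  have "0 < emeasure lborel (ball z e)"
    using content_ball_pos[OF assms(1), of z] by (auto simp: measure_def enn2real_positive_iff)
  also have "\<dots> \<le> emeasure hyp_area (ball z e)"
    by (rule lborel_le_hyp_area) (use assms in auto)
  finally show ?thesis .
qed

lemma factor_measure_ball_pos:
  assumes "continuous_on unit_disk \<mu>" "\<And>z. z \<in> unit_disk \<Longrightarrow> \<mu> z > 0"
    and "e > 0" "ball z e \<subseteq> unit_disk"
  shows "0 < emeasure (factor_measure \<mu>) (ball z e)"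
proof (rule ccontr)
  assume "\<not> ?thesis"
  then have 0: "emeasure (factor_measure \<mu>) (ball z e) = 0" by simp
  have meas: "(\<lambda>z. ennreal (\<mu> z)) \<in> borel_measurable hyp_area"
    using borel_measurable_hyp_area[OF assms(1)] by measurable
  have B: "ball z e \<in> sets hyp_area" using assms by (simp add: sets_hyp_area)
  have "(\<integral>\<^sup>+x. ennreal (\<mu> x) * indicator (ball z e) x \<partial>hyp_area) = 0"
    using 0 unfolding factor_measure_def emeasure_density[OF meas B] .
  then have "AE x in hyp_area. ennreal (\<mu> x) * indicator (ball z e) x = 0"
    using meas B by (subst (asm) nn_integral_0_iff_AE) auto
  then have "AE x in hyp_area. x \<notin> ball z e"
  proof (rule AE_mp, intro AE_I2 impI)
    fix x assume x: "x \<in> space hyp_area" "ennreal (\<mu> x) * indicator (ball z e) x = 0"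
    then have "\<mu> x > 0" using assms(2) by simp
    then show "x \<notin> ball z e" using x(2) by (auto simp: indicator_def split: if_splits)
  qed
  then have "emeasure hyp_area (ball z e) = 0"
    using B by (subst (asm) AE_iff_measurable[of "ball z e"]) (auto simp: sets_hyp_area)
  then show False
    using hyp_area_ball_pos[OF assms(3,4)] by simp
qed

text \<open>Continuity from below along the balls of radius \<open>1 - 1 / (n + 1)\<close>, which
  exhaust the disk. It provides a compact set carrying almost all of the mass.\<close>

lemma factor_measure_cball_near_full:
  assumes "continuous_on unit_disk \<nu>" "(\<integral>\<^sup>+z. ennreal (\<nu> z) \<partial>hyp_area) = 1" "c < 1"
  obtains s where "0 \<le> s" "s < 1" "c < emeasure (factor_measure \<nu>) (cball 0 s)"
proof -
  define s where "s n = 1 - 1 / (real n + 1)" for n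
  have s: "0 \<le> s n" "s n < 1" for n by (simp_all add: s_def)
  have sets: "cball 0 (s n) \<in> sets (factor_measure \<nu>)" for n
    using s(2)[of n] by (simp add: factor_measure_def sets_hyp_area subset_iff)
  have "incseq (\<lambda>n. cball (0::complex) (s n))"
    by (intro incseq_SucI subset_cball) (simp add: s_def field_simps)
  then have "(SUP n. emeasure (factor_measure \<nu>) (cball 0 (s n)))
      = emeasure (factor_measure \<nu>) (\<Union>n. cball 0 (s n))"
    using sets by (intro SUP_emeasure_incseq) auto
  also have "(\<Union>n. cball (0::complex) (s n)) = unit_disk"
  proof (intro equalityI subsetI)
    fix x :: complex assume "x \<in> unit_disk"
    then have "0 < 1 - cmod x" by simp
    then obtain n where "inverse (real (Suc n)) < 1 - cmod x"
      using reals_Archimedean by blast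
    then have "x \<in> cball 0 (s n)" by (simp add: s_def inverse_eq_divide add.commute)
    then show "x \<in> (\<Union>n. cball 0 (s n))" by blast
  next
    fix x :: complex assume "x \<in> (\<Union>n. cball 0 (s n))"
    then obtain n where "cmod x \<le> s n" by auto
    also note s(2)
    finally show "x \<in> unit_disk" by simp
  qed
  also have "emeasure (factor_measure \<nu>) unit_disk = 1"
  proof -
    have "emeasure (factor_measure \<nu>) unit_disk
        = (\<integral>\<^sup>+z. ennreal (\<nu> z) * indicator unit_disk z \<partial>hyp_area)"
      unfolding factor_measure_def using borel_measurable_hyp_area[OF assms(1)]
      by (intro emeasure_density) (auto simp: sets_hyp_area)
    also have "\<dots> = (\<integral>\<^sup>+z. ennreal (\<nu> z) \<partial>hyp_area)"
      by (intro nn_integral_cong) auto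
    finally show ?thesis using assms(2) by simp
  qed
  finally have "c < (SUP n. emeasure (factor_measure \<nu>) (cball 0 (s n)))"
    using assms(3) by simp
  then obtain n where "c < emeasure (factor_measure \<nu>) (cball 0 (s n))"
    by (auto simp: less_SUP_iff)
  then show thesis using that s by blast
qed

text \<open>Inclusion-exclusion for the preimages of \<open>A\<close> and \<open>B\<close> under the
  projections: their intersection is the rectangle, and their union has mass at most 1.\<close>

lemma emeasure_fst_snd_coupling:
  assumes "\<pi> \<in> couplings \<mu> \<nu>" "A \<in> sets hyp_area" "B \<in> sets hyp_area"
  shows "emeasure (factor_measure \<mu>) A + emeasure (factor_measure \<nu>) B \<le> 1 + emeasure \<pi> (A \<times> B)"
    and "A \<times> B \<in> sets \<pi>"
proof -
  have pr: "prob_space \<pi>" and sets: "sets \<pi> = sets (hyp_area \<Otimes>\<^sub>M hyp_area)"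
    and fst: "distr \<pi> hyp_area fst = factor_measure \<mu>"
    and snd: "distr \<pi> hyp_area snd = factor_measure \<nu>"
    using assms(1) by (auto simp: couplings_def)
  interpret prob_space \<pi> by (rule pr)
  have space: "space \<pi> = unit_disk \<times> unit_disk"
    using sets_eq_imp_space_eq[OF sets] by (simp add: space_pair_measure)
  have m: "fst \<in> measurable \<pi> hyp_area" "snd \<in> measurable \<pi> hyp_area"
    using sets by (simp_all cong: measurable_cong_sets)
  let ?A = "fst -` A \<inter> space \<pi>" and ?B = "snd -` B \<inter> space \<pi>"
  have AB: "?A \<in> sets \<pi>" "?B \<in> sets \<pi>"
    using m assms(2,3) by (auto intro: measurable_sets)
  have prod: "?A \<inter> ?B = A \<times> B"
    using assms(2,3) by (auto simp: space sets_hyp_area)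
  show "A \<times> B \<in> sets \<pi>"
    using AB prod by (metis sets.Int)
  have "emeasure (factor_measure \<mu>) A + emeasure (factor_measure \<nu>) B = emeasure \<pi> ?A + emeasure \<pi> ?B"
    unfolding fst[symmetric] snd[symmetric] using m assms by (simp add: emeasure_distr)
  also have "\<dots> = emeasure \<pi> (?A \<union> ?B) + emeasure \<pi> (?A \<inter> ?B)"
    by (rule emeasure_Un_Int[OF AB])
  also have "\<dots> \<le> 1 + emeasure \<pi> (A \<times> B)"
    unfolding prod by (intro add_mono emeasure_le_1 order_refl)
  finally show "emeasure (factor_measure \<mu>) A + emeasure (factor_measure \<nu>) B \<le> 1 + emeasure \<pi> (A \<times> B)" .
qed

section \<open>Almost matching automorphisms and their limit\<close>

text \<open>A Markov-type argument: a mismatch of at least \<open>c\<close> on a rectangle of mass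
  at least \<kappa> would cost at least \<open>c * \<kappa>\<close>. The radius \<open>s\<close> is
  fixed before \<open>c\<close>, which later confines the automorphisms for all \<open>c\<close> to
  one compact family.\<close>

lemma small_mismatch:
  assumes "continuous_on unit_disk \<mu>" "\<And>z. z \<in> unit_disk \<Longrightarrow> \<mu> z > 0"
    and "continuous_on unit_disk \<nu>" "(\<integral>\<^sup>+z. ennreal (\<nu> z) \<partial>hyp_area) = 1"
    and "conformal_wasserstein R \<mu> \<nu> = 0"
    and "e > 0" "ball z0 e \<subseteq> unit_disk"
  obtains s where "0 \<le> s" "s < 1"
    "\<And>c. c > 0 \<Longrightarrow> \<exists>z\<in>ball z0 e. \<exists>m\<in>disk_moebius. cmod (m z) \<le> s \<and>
       (\<integral>\<^sup>+x\<in>hyp_disk z R. ennreal \<bar>\<mu> x - \<nu> (m x)\<bar> \<partial>hyp_area) < c"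
proof -
  let ?B = "ball z0 e"
  \<comment> \<open>Capping at 1 keeps the truncated subtraction \<open>1 - b\<close>
    harmless.\<close>
  define b where "b = min 1 (emeasure (factor_measure \<mu>) ?B)"
  have "0 < b" "b \<le> 1"
    using factor_measure_ball_pos[OF assms(1,2,6,7)] by (auto simp: b_def)
  then have "1 - b < 1"
    by (intro ennreal_between) auto
  then obtain s where s: "0 \<le> s" "s < 1" "1 - b < emeasure (factor_measure \<nu>) (cball 0 s)"
    using factor_measure_cball_near_full[OF assms(3,4)] by metis
  \<comment> \<open>The excess of the two masses over 1, hence a lower bound for the mass that any
    coupling gives to the rectangle.\<close>
  define \<kappa> where "\<kappa> = b + emeasure (factor_measure \<nu>) (cball 0 s) - 1"
  have "1 < emeasure (factor_measure \<nu>) (cball 0 s) + b"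
    using s(3) \<open>b \<le> 1\<close> by (subst (asm) minus_less_iff_ennreal) (auto intro: order_le_less_trans)
  then have "\<kappa> > 0"
    unfolding \<kappa>_def by (simp add: diff_gr0_ennreal add.commute)
  show thesis
  proof (rule that[OF s(1,2)])
    fix c :: ennreal assume "c > 0"
    then have "conformal_wasserstein R \<mu> \<nu> < c * \<kappa>"
      using \<open>\<kappa> > 0\<close> assms(5) by (simp add: ennreal_zero_less_mult_iff)
    then obtain \<pi> where \<pi>: "\<pi> \<in> couplings \<mu> \<nu>"
      and less: "(\<integral>\<^sup>+x. local_mismatch R \<mu> \<nu> (fst x) (snd x) \<partial>\<pi>) < c * \<kappa>"
      by (auto simp: conformal_wasserstein_def INF_less_iff)
    have BK: "?B \<in> sets hyp_area" "cball 0 s \<in> sets hyp_area"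
      using assms(7) s by (auto simp: sets_hyp_area)
    note cpl = emeasure_fst_snd_coupling[OF \<pi> BK]
    have "b + emeasure (factor_measure \<nu>) (cball 0 s)
        \<le> emeasure (factor_measure \<mu>) ?B + emeasure (factor_measure \<nu>) (cball 0 s)"
      by (intro add_mono) (auto simp: b_def)
    also note cpl(1)
    finally have \<kappa>: "\<kappa> \<le> emeasure \<pi> (?B \<times> cball 0 s)"
      unfolding \<kappa>_def by (subst ennreal_minus_le_iff) auto
    have "\<exists>z\<in>?B. \<exists>w\<in>cball 0 s. local_mismatch R \<mu> \<nu> z w < c"
    proof (rule ccontr)
      assume "\<not> ?thesis"
      then have ge: "c \<le> local_mismatch R \<mu> \<nu> z w" if "z \<in> ?B" "w \<in> cball 0 s" for z w
        using that by (meson not_less)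
      have "c * \<kappa> \<le> c * emeasure \<pi> (?B \<times> cball 0 s)"
        using \<kappa> by (intro mult_left_mono) auto
      also have "\<dots> = (\<integral>\<^sup>+x. c * indicator (?B \<times> cball 0 s) x \<partial>\<pi>)"
        using cpl(2) by (rule nn_integral_cmult_indicator[symmetric])
      \<comment> \<open>Monotonicity of the nonnegative integral holds for arbitrary integrands, so
        a pointwise comparison is enough.\<close>
      also have "\<dots> \<le> (\<integral>\<^sup>+x. local_mismatch R \<mu> \<nu> (fst x) (snd x) \<partial>\<pi>)"
        using ge by (intro nn_integral_mono) (auto simp: indicator_def)
      finally show False using less by simp
    qed
    then obtain z w where zw: "z \<in> ?B" "w \<in> cball 0 s" "local_mismatch R \<mu> \<nu> z w < c" by blast
    then obtain m where "m \<in> disk_moebius" "m z = w"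
      "(\<integral>\<^sup>+x\<in>hyp_disk z R. ennreal \<bar>\<mu> x - \<nu> (m x)\<bar> \<partial>hyp_area) < c"
      unfolding local_mismatch_def INF_less_iff by blast
    then show "\<exists>z\<in>ball z0 e. \<exists>m\<in>disk_moebius. cmod (m z) \<le> s \<and>
       (\<integral>\<^sup>+x\<in>hyp_disk z R. ennreal \<bar>\<mu> x - \<nu> (m x)\<bar> \<partial>hyp_area) < c"
      using zw by auto
  qed
qed

text \<open>The zero \<open>a\<close> of a disk automorphism that moves a point \<open>z\<close> of a compact set to a point of a
  compact set stays in a compact set.\<close>

lemma norm_moebius_zero_le:
  assumes "cmod a < 1" "cmod z \<le> t" "t < 1" "pdist a z \<le> s" "s < 1"
  shows "(cmod a)\<^sup>2 \<le> 1 - (1 - s\<^sup>2) * (1 - t)\<^sup>2"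
proof -
  have z: "cmod z < 1" using assms by simp
  have "1 - t \<le> cmod (1 - cnj a * z)"
  proof -
    have "cmod (cnj a * z) \<le> 1 * t"
      unfolding norm_mult using assms by (intro mult_mono) auto
    then show ?thesis using norm_triangle_ineq2[of 1 "cnj a * z"] by simp
  qed
  then have 1: "(1 - t)\<^sup>2 \<le> (cmod (1 - cnj a * z))\<^sup>2"
    using assms by (intro power_mono) auto
  have 2: "1 - s\<^sup>2 \<le> 1 - (pdist a z)\<^sup>2"
    using assms by (simp add: power_mono)
  have "0 \<le> s" using assms(4) pdist_nonneg order_trans by blast
  then have s: "0 \<le> 1 - s\<^sup>2" using assms(5) by (simp add: power_le_one)
  \<comment> \<open>The right side is the multiplied-out form of
    \<open>one_minus_pdist\<close>.\<close>
  have "(1 - s\<^sup>2) * (1 - t)\<^sup>2 \<le> (1 - (pdist a z)\<^sup>2) * (cmod (1 - cnj a * z))\<^sup>2"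
    using 1 2 s by (intro mult_mono) auto
  also have "\<dots> = (1 - (cmod a)\<^sup>2) * (1 - (cmod z)\<^sup>2)"
    using one_minus_cnj_mult_nonzero[OF assms(1) z] by (simp add: one_minus_pdist[OF assms(1) z])
  also have "\<dots> \<le> (1 - (cmod a)\<^sup>2) * 1"
    using assms(1) by (intro mult_left_mono) (auto simp: power_le_one)
  finally show ?thesis by simp
qed

text \<open>Automorphisms with mismatch below \<open>1 / (n + 1)\<close> have parameters in a
  compact set, and a limit point gives the match. Radius is lost because their centres are only near
  \<open>z0\<close>; the region is open, so a discrepancy at one point would spread to a ball of
  positive area.\<close>

lemma local_match:
  assumes \<mu>: "continuous_on unit_disk \<mu>" "\<And>z. z \<in> unit_disk \<Longrightarrow> \<mu> z > 0"
    and \<nu>: "continuous_on unit_disk \<nu>" "(\<integral>\<^sup>+z. ennreal (\<nu> z) \<partial>hyp_area) = 1"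
    and cw: "conformal_wasserstein R \<mu> \<nu> = 0"
    and z0: "z0 \<in> unit_disk" and r: "r < tanh R"
  shows "\<exists>m\<in>disk_moebius. \<forall>x\<in>unit_disk. pdist z0 x < r \<longrightarrow> \<nu> (m x) = \<mu> x"
proof -
  have "eventually (\<lambda>z. \<forall>x\<in>unit_disk. pdist z0 x \<le> r \<longrightarrow> pdist z x \<le> tanh R) (at z0)"
    by (rule eventually_pdist_le) (use z0 r in auto)
  then obtain e1 where "e1 > 0" and near: "\<forall>z\<in>UNIV. z \<noteq> z0 \<and> dist z z0 < e1 \<longrightarrow>
      (\<forall>x\<in>unit_disk. pdist z0 x \<le> r \<longrightarrow> pdist z x \<le> tanh R)"
    unfolding eventually_at by blast
  have e1: "pdist z x \<le> tanh R" if "z \<in> ball z0 e1" "x \<in> unit_disk" "pdist z0 x \<le> r" for z x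
    using near that r by (cases "z = z0") (auto simp: dist_commute)
  \<comment> \<open>Going at most halfway to the unit circle bounds all centres by \<open>t\<close>,
    the midpoint of \<open>cmod z0\<close> and 1.\<close>
  define e where "e = min e1 ((1 - cmod z0) / 2)"
  define t where "t = (1 + cmod z0) / 2"
  have e: "e > 0" "t < 1" using z0 \<open>e1 > 0\<close> by (auto simp: e_def t_def)
  have et: "cmod z \<le> t" if "z \<in> ball z0 e" for z
  proof -
    have "cmod z \<le> cmod z0 + dist z0 z"
      using norm_triangle_ineq[of z0 "z - z0"] by (simp add: dist_norm norm_minus_commute)
    then show ?thesis using that unfolding e_def t_def by (simp add: field_simps)
  qed
  have sub: "ball z0 e \<subseteq> unit_disk"
  proof
    fix x assume "x \<in> ball z0 e"
    from et[OF this] e(2) show "x \<in> unit_disk" by simp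
  qed
  obtain s where s: "0 \<le> s" "s < 1" and sm:
    "\<And>c. c > 0 \<Longrightarrow> \<exists>z\<in>ball z0 e. \<exists>m\<in>disk_moebius. cmod (m z) \<le> s \<and>
       (\<integral>\<^sup>+x\<in>hyp_disk z R. ennreal \<bar>\<mu> x - \<nu> (m x)\<bar> \<partial>hyp_area) < c"
    by (rule small_mismatch[OF \<mu> \<nu> cw e(1) sub], assumption, rule that)
  \<comment> \<open>The bound of \<open>norm_moebius_zero_le\<close> for the zeros of the
    automorphisms.\<close>
  define T where "T = sqrt (1 - (1 - s\<^sup>2) * (1 - t)\<^sup>2)"
  have "0 < (1 - s\<^sup>2) * (1 - t)\<^sup>2"
    using s e by (intro mult_pos_pos) (auto simp: abs_square_less_1)
  then have T: "T < 1" by (simp add: T_def)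
  define mb where "mb = (\<lambda>q x. fst q * (x - snd q) / (1 - cnj (snd q) * x))"
  \<comment> \<open>The region is fixed and lies in \<open>hyp_disk z R\<close> for every centre
    \<open>z\<close> in \<open>ball z0 e1\<close>, so mismatches with different centres become
    comparable.\<close>
  define I where "I = (\<lambda>p. \<integral>\<^sup>+x. ennreal \<bar>\<mu> x - \<nu> (mb p x)\<bar> * indicator {x \<in> unit_disk. pdist z0 x < r} x \<partial>hyp_area)"
  have ex: "\<forall>n. \<exists>p. p \<in> sphere 0 1 \<times> cball 0 T \<and> I p < ennreal (1 / (real n + 1))"
  proof
    fix n :: nat
    have "0 < ennreal (1 / (real n + 1))" by simp
    from sm[OF this] obtain z m where z: "z \<in> ball z0 e" and m: "m \<in> disk_moebius" "cmod (m z) \<le> s"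
      and int: "(\<integral>\<^sup>+x\<in>hyp_disk z R. ennreal \<bar>\<mu> x - \<nu> (m x)\<bar> \<partial>hyp_area) < ennreal (1 / (real n + 1))"
      by blast
    obtain u a where ua: "m = (\<lambda>z. u * (z - a) / (1 - cnj a * z))" "cmod u = 1" "cmod a < 1"
      using m(1) by (auto simp: disk_moebius_eq)
    have "cmod (m z) = pdist a z"
      unfolding ua(1) by (rule norm_disk_moebius[OF ua(2)])
    then have "pdist a z \<le> s" using m(2) by simp
    then have "(cmod a)\<^sup>2 \<le> 1 - (1 - s\<^sup>2) * (1 - t)\<^sup>2"
      using norm_moebius_zero_le[OF ua(3) et[OF z] e(2) _ s(2)] by blast
    then have "cmod a \<le> T"
      unfolding T_def by (rule real_le_rsqrt)
    then have ua': "(u, a) \<in> sphere 0 1 \<times> cball 0 T" using ua(2) by simp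
    have mb: "mb (u, a) = m" by (simp add: mb_def ua(1))
    have "z \<in> ball z0 e1" using z by (simp add: e_def)
    then have sub': "{x \<in> unit_disk. pdist z0 x < r} \<subseteq> hyp_disk z R"
      using e1[of z] by (auto simp: hyp_disk_def pdist_def)
    have "I (u, a) \<le> (\<integral>\<^sup>+x\<in>hyp_disk z R. ennreal \<bar>\<mu> x - \<nu> (m x)\<bar> \<partial>hyp_area)"
      unfolding I_def mb using sub' by (rule nn_set_integral_set_mono)
    also note int
    finally show "\<exists>p. p \<in> sphere 0 1 \<times> cball 0 T \<and> I p < ennreal (1 / (real n + 1))"
      using ua' by blast
  qed
  obtain q where "\<forall>n. q n \<in> sphere 0 1 \<times> cball 0 T \<and> I (q n) < ennreal (1 / (real n + 1))"
    using choice[OF ex] by (rule exE)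
  then have q: "\<forall>n. q n \<in> sphere 0 1 \<times> cball 0 T" and int: "\<And>n. I (q n) < ennreal (1 / (real n + 1))"
    by simp_all
  have "compact (sphere (0::complex) 1 \<times> cball (0::complex) T)"
    by (intro compact_Times) auto
  from this[unfolded compact_def, THEN spec, THEN mp, OF q]
  have "\<exists>l\<in>sphere 0 1 \<times> cball 0 T. \<exists>k. strict_mono k \<and> (q \<circ> k) \<longlonglongrightarrow> l"
    .
  then obtain l k where l: "l \<in> sphere 0 1 \<times> cball 0 T" and k: "strict_mono (k :: nat \<Rightarrow> nat)"
    and lim: "(q \<circ> k) \<longlonglongrightarrow> l"
    by blast
  have mb: "mb p \<in> disk_moebius" if "p \<in> sphere 0 1 \<times> cball 0 T" for p
    unfolding mb_def by (rule disk_moebiusI) (use that T in auto)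
  have "\<nu> (mb l x) = \<mu> x" if x: "x \<in> unit_disk" "pdist z0 x < r" for x
  proof (rule ccontr)
    assume "\<nu> (mb l x) \<noteq> \<mu> x"
    \<comment> \<open>The discrepancy is treated as jointly continuous in parameter and point, so
      that it stays above \<open>g / 2\<close> for parameters near \<open>l\<close> and points near
      \<open>x\<close> at once.\<close>
    define G where "G = (\<lambda>p. \<bar>\<mu> (snd p) - \<nu> (mb (fst p) (snd p))\<bar>)"
    define D where "D = (sphere (0::complex) 1 \<times> cball (0::complex) T) \<times> unit_disk"
    have D: "cnj (snd (fst p)) * snd p \<noteq> 1" if "p \<in> D" for p
      using that T one_minus_cnj_mult_nonzero[of "snd (fst p)" "snd p"] unfolding D_def by auto
    have "continuous_on D (\<lambda>p. mb (fst p) (snd p))"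
      unfolding mb_def using D by (auto intro!: continuous_intros)
    moreover have "(\<lambda>p. mb (fst p) (snd p)) ` D \<subseteq> unit_disk"
      using mb disk_moebius_maps unfolding D_def by fastforce
    ultimately have "continuous_on D (\<lambda>p. \<nu> (mb (fst p) (snd p)))"
      using \<nu>(1) continuous_on_compose2 by blast
    moreover have "continuous_on D (\<lambda>p. \<mu> (snd p))"
      by (rule continuous_on_compose2[OF \<mu>(1)]) (auto simp: D_def intro: continuous_intros)
    ultimately have G: "continuous_on D G"
      unfolding G_def by (intro continuous_intros)
    define g where "g = G (l, x)"
    have g: "g > 0" using \<open>\<nu> (mb l x) \<noteq> \<mu> x\<close> by (simp add: g_def G_def)
    have lx: "(l, x) \<in> D" using l x by (simp add: D_def)
    obtain d1 where d1: "d1 > 0" "\<And>p. p \<in> D \<Longrightarrow> dist p (l, x) < d1 \<Longrightarrow> dist (G p) g < g / 2"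
      using continuous_on_iff[THEN iffD1, rule_format, OF G lx, of "g / 2"] g
      unfolding g_def by auto
    obtain d2 where d2: "d2 > 0" "\<And>y. y \<in> unit_disk \<Longrightarrow> dist y x < d2 \<Longrightarrow> dist (pdist z0 y) (pdist z0 x) < r - pdist z0 x"
      using continuous_on_iff[THEN iffD1, rule_format, OF continuous_on_pdist[of z0], of x "r - pdist z0 x"] z0 x
      by auto
    obtain d3 where d3: "d3 > 0" "ball x d3 \<subseteq> unit_disk"
      using x open_ball open_contains_ball by blast
    \<comment> \<open>Half of \<open>d1\<close> is reserved for the point and half for the
      parameter; \<open>d2\<close> keeps the ball inside the open region and \<open>d3\<close>
      inside the disk.\<close>
    define d where "d = min (d1 / 2) (min d2 d3)"
    have d: "d > 0" "d \<le> d1 / 2" "d \<le> d2" "d \<le> d3" using d1 d2 d3 by (auto simp: d_def)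
    define B where "B = ball x d"
    have Bd: "B \<subseteq> unit_disk" using d d3 by (auto simp: B_def)
    have "0 < emeasure hyp_area B"
      unfolding B_def by (rule hyp_area_ball_pos) (use d Bd B_def in auto)
    then have pos: "0 < ennreal (g / 2) * emeasure hyp_area B"
      using g by (simp add: ennreal_zero_less_mult_iff)
    have "eventually (\<lambda>n. dist ((q \<circ> k) n) l < d1 / 2) sequentially"
      by (rule tendstoD[OF lim]) (use d1(1) in simp)
    \<comment> \<open>A fixed positive quantity is squeezed under a null sequence; passing to the
      subsequence is harmless as \<open>n \<le> k n\<close>.\<close>
    then have ev: "eventually (\<lambda>n. ennreal (g / 2) * emeasure hyp_area B \<le> ennreal (1 / (real n + 1))) sequentially"
    proof eventually_elim
      case (elim n)
      have "ennreal (g / 2) * emeasure hyp_area B = (\<integral>\<^sup>+y. ennreal (g / 2) * indicator B y \<partial>hyp_area)"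
        using Bd by (intro nn_integral_cmult_indicator[symmetric]) (simp add: sets_hyp_area B_def)
      also have "\<dots> \<le> I (q (k n))"
        unfolding I_def
      proof (rule nn_integral_mono)
        fix y
        have "g / 2 \<le> \<bar>\<mu> y - \<nu> (mb (q (k n)) y)\<bar> \<and> y \<in> {x \<in> unit_disk. pdist z0 x < r}" if y: "y \<in> B"
        proof -
          have yd: "y \<in> unit_disk" "dist y x < d" using y Bd by (auto simp: B_def dist_commute)
          have "dist (q (k n), y) (l, x) \<le> dist (q (k n)) l + dist y x"
            unfolding dist_prod_def fst_conv snd_conv by (rule sqrt_sum_squares_le_sum) auto
          also have "\<dots> < d1" using elim yd d by simp
          finally have "dist (G (q (k n), y)) g < g / 2"
            using d1(2) q[rule_format] yd by (simp add: D_def)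
          then have "g / 2 \<le> G (q (k n), y)" by (simp add: dist_real_def abs_if split: if_splits)
          moreover have "dist (pdist z0 y) (pdist z0 x) < r - pdist z0 x"
            using d2(2) yd d by simp
          ultimately show ?thesis using yd by (simp add: G_def dist_real_def)
        qed
        then show "ennreal (g / 2) * indicator B y
          \<le> ennreal \<bar>\<mu> y - \<nu> (mb (q (k n)) y)\<bar> * indicator {x \<in> unit_disk. pdist z0 x < r} y"
          by (cases "y \<in> B") (auto simp: ennreal_leI)
      qed
      also have "\<dots> \<le> ennreal (1 / (real (k n) + 1))"
        using int less_imp_le by blast
      also have "\<dots> \<le> ennreal (1 / (real n + 1))"
        using seq_suble[OF k, of n] by (intro ennreal_leI frac_le) auto
      finally show ?case .
    qed
    have "(\<lambda>n. 1 / (real n + 1)) \<longlonglongrightarrow> 0"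
      using LIMSEQ_inverse_real_of_nat by (simp add: inverse_eq_divide add.commute)
    then have "(\<lambda>n. ennreal (1 / (real n + 1))) \<longlonglongrightarrow> ennreal 0"
      by (rule tendsto_ennrealI)
    then have "ennreal (g / 2) * emeasure hyp_area B \<le> ennreal 0"
      using ev by (rule tendsto_lowerbound) simp
    then show False using pos by auto
  qed
  then show ?thesis using mb[OF l] by blast
qed

section \<open>Uniqueness of the match and gluing over the disk\<close>

text \<open>The composite \<open>h\<close> of \<open>n\<close> with the inverse of \<open>m\<close>
  preserves \<nu> on the hyperbolic disk about \<open>m z0\<close>, because \<open>m\<close>
  preserves \<open>pdist\<close>. Single fittability then forces \<open>h\<close> to be the identity
  on the disk.\<close>

lemma disk_moebius_unique_match:
  assumes N: "singly_fittable \<rho> N" "conformal_factor N \<nu>" "R > \<rho>"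
    and m: "m \<in> disk_moebius" "n \<in> disk_moebius" and z0: "z0 \<in> unit_disk"
    and eq: "\<And>x. x \<in> unit_disk \<Longrightarrow> pdist z0 x \<le> tanh R \<Longrightarrow> \<nu> (m x) = \<nu> (n x)"
    and x: "x \<in> unit_disk"
  shows "m x = n x"
proof -
  obtain m' where m': "m' \<in> disk_moebius" "\<And>z. z \<in> unit_disk \<Longrightarrow> m (m' z) = z"
    "\<And>z. z \<in> unit_disk \<Longrightarrow> m' (m z) = z"
    using disk_moebius_inverse[OF m(1)] by blast
  obtain h where h: "h \<in> disk_moebius" "\<And>z. z \<in> unit_disk \<Longrightarrow> h z = n (m' z)"
    using disk_moebius_compose[OF m(2) m'(1)] by blast
  have w0: "m z0 \<in> unit_disk" using disk_moebius_maps m z0 by blast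
  have "\<nu> y = \<nu> (h y)" if y: "y \<in> hyp_disk (m z0) R" for y
  proof -
    have yd: "y \<in> unit_disk" and "pdist (m z0) y \<le> tanh R"
      using y by (auto simp: hyp_disk_def pdist_def)
    moreover have "m' y \<in> unit_disk" using disk_moebius_maps m'(1) yd by blast
    moreover have "pdist (m z0) y = pdist z0 (m' y)"
      using pdist_disk_moebius[OF m(1) z0, of "m' y"] calculation m'(2)[OF yd] by simp
    ultimately have "\<nu> (m (m' y)) = \<nu> (n (m' y))" using eq by simp
    then show ?thesis using yd by (simp add: h m')
  qed
  then have "(\<integral>\<^sup>+z\<in>hyp_disk (m z0) R. ennreal \<bar>\<nu> z - \<nu> (h z)\<bar> \<partial>hyp_area) = (\<integral>\<^sup>+z. 0 \<partial>hyp_area)"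
    by (intro nn_integral_cong) (auto simp: indicator_def)
  then have "(\<integral>\<^sup>+z\<in>hyp_disk (m z0) R. ennreal \<bar>\<nu> z - \<nu> (h z)\<bar> \<partial>hyp_area) = 0"
    by simp
  then have "\<forall>z\<in>unit_disk. h z = z"
    using N w0 h(1) unfolding singly_fittable_def by blast
  moreover have "m x \<in> unit_disk" using disk_moebius_maps m x by blast
  ultimately show ?thesis using h(2) m'(3)[OF x] by metis
qed

lemma conformal_factorD:
  assumes "conformal_factor S \<mu>"
  shows "continuous_on unit_disk \<mu>" "z \<in> unit_disk \<Longrightarrow> \<mu> z > 0"
proof -
  have "Ck_on 0 unit_disk \<mu>"
    using assms unfolding conformal_factor_def conformal_factor_via_def smooth_on_def by blast
  then show "continuous_on unit_disk \<mu>" by simp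
  show "z \<in> unit_disk \<Longrightarrow> \<mu> z > 0"
    using assms unfolding conformal_factor_def conformal_factor_via_def by blast
qed

theorem theorem3p15:
  fixes \<rho> R :: real
    and M :: "'a surface" and N :: "'b surface"
    and \<mu> \<nu> :: "complex \<Rightarrow> real"
  assumes "\<rho> > 0"
    and "disk_type_surface M" and "disk_type_surface N"
    and "conformal_factor M \<mu>" and "conformal_factor N \<nu>"
    and "singly_fittable \<rho> M" and "singly_fittable \<rho> N"
    and "R > \<rho>" and "conformal_wasserstein R \<mu> \<nu> = 0"
  shows "\<exists>m\<in>disk_moebius. \<forall>z\<in>unit_disk. \<nu> (m z) = \<mu> z"
proof -
  \<comment> \<open>Three nested radii: matches hold up to \<open>r'\<close>, uniqueness is tested
    on radius \<open>R1\<close>, and \<open>r\<close> leaves room for moving the centre.\<close>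
  obtain R1 where R1: "\<rho> < R1" "R1 < R" using assms(8) dense by blast
  obtain r' where r': "tanh R1 < r'" "r' < tanh R"
    using dense[of "tanh R1" "tanh R"] R1 by auto
  obtain r where r: "tanh R1 < r" "r < r'" using dense r'(1) by blast
  have int: "(\<integral>\<^sup>+z. ennreal (\<nu> z) \<partial>hyp_area) = 1"
    using assms(3,5) by (simp add: disk_type_surface_def)
  have "\<forall>z\<in>unit_disk. \<exists>m\<in>disk_moebius. \<forall>x\<in>unit_disk. pdist z x < r' \<longrightarrow> \<nu> (m x) = \<mu> x"
    using local_match[OF conformal_factorD[OF assms(4)] conformal_factorD(1)[OF assms(5)] int assms(9) _ r'(2)]
    by blast
  then obtain m where m: "\<And>z. z \<in> unit_disk \<Longrightarrow> m z \<in> disk_moebius"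
    "\<And>z x. z \<in> unit_disk \<Longrightarrow> x \<in> unit_disk \<Longrightarrow> pdist z x < r' \<Longrightarrow> \<nu> (m z x) = \<mu> x"
    by metis
  \<comment> \<open>Automorphisms are functions on all of \<open>complex\<close> that are compared
    only on the disk; restriction turns agreement there into equality, so that a locally constant
    map on a connected set results.\<close>
  have "restrict (m z) unit_disk = restrict (m 0) unit_disk" if "z \<in> unit_disk" for z
  proof (rule connected_local_const[of unit_disk])
    show "\<forall>a\<in>unit_disk. eventually (\<lambda>b. restrict (m a) unit_disk = restrict (m b) unit_disk) (at a within unit_disk)"
    proof
      fix a :: complex assume a: "a \<in> unit_disk"
      have "eventually (\<lambda>b. \<forall>x\<in>unit_disk. pdist a x \<le> tanh R1 \<longrightarrow> pdist b x \<le> r) (at a within unit_disk)"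
        by (rule filter_leD[OF at_le[OF subset_UNIV]], rule eventually_pdist_le) (use a r in auto)
      moreover have "eventually (\<lambda>b. b \<in> unit_disk) (at a within unit_disk)"
        by (auto simp: eventually_at_filter)
      ultimately show "eventually (\<lambda>b. restrict (m a) unit_disk = restrict (m b) unit_disk) (at a within unit_disk)"
      proof eventually_elim
        case (elim b)
        have "m a x = m b x" if "x \<in> unit_disk" for x
        proof (rule disk_moebius_unique_match[OF assms(7,5) R1(1) m(1)[OF a] m(1) a _ that])
          fix y assume y: "y \<in> unit_disk" "pdist a y \<le> tanh R1"
          then have "pdist b y \<le> r" using elim by blast
          then show "\<nu> (m a y) = \<nu> (m b y)"
            using m(2)[OF a y(1)] m(2)[of b y] y elim r by simp
        qed (use elim in auto)
        then show ?case by (auto intro: restrict_ext)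
      qed
    qed
  qed (use that in auto)
  \<comment> \<open>Each point serves as its own centre: the match chosen for \<open>z\<close> is
    valid at \<open>z\<close>, and its value there is that of \<open>m 0\<close>.\<close>
  then have "m z z = m 0 z" if "z \<in> unit_disk" for z
    using that by (metis restrict_apply')
  moreover have "\<nu> (m z z) = \<mu> z" if "z \<in> unit_disk" for z
  proof -
    have "0 \<le> tanh R1" using R1 assms(1) by simp
    moreover have "pdist z z = 0" by (simp add: pdist_def)
    ultimately have "pdist z z < r'" using r by linarith
    then show ?thesis using m(2)[OF that that] by blast
  qed
  ultimately show ?thesis
    using m(1)[of 0] by (intro bexI[of _ "m 0"]) auto
qed

end
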